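(* Let $\theta>0$ with $\theta\neq 1$, and let $F$ be a Weibull-type distribution function with Weibull-tail coefficient $\theta$, that is, for some $x_0\ge 0$, $$1-F(x)=\exp(-H(x)),\qquad H(x)=x^{1/\theta}\,l(x),\qquad x\ge x_0,$$ where $l$ is a (positive) slowly varying function at infinity which is four times differentiable on a neighbourhood of $+\infty$. Assume that, as $x\to\infty$, $$\frac{x\,l'(x)}{l(x)}\to 0,\qquad \frac{x^2\,l''(x)}{l(x)}\to 0,\qquad \frac{x^3\,l'''(x)}{l(x)}\to 0,\qquad \frac{x^4\,l^{(iv)}(x)}{l(x)}\to 0 .$$ For all sufficiently large $x$ put $$k(x)=\frac{d}{dx}\bigl[-\log(-\log F(x))\bigr],\qquad \varphi(x)=\Bigl(\frac1k\Bigr)'(x)=-\frac{k'(x)}{(k(x))^2},$$ and let $x^F=\sup\{x:F(x)<1\}$. Then $F$ satisfies the von Mises first order, second order and penultimate conditions $$\lim_{t\to x^F}\varphi(t)=0,\qquad \lim_{t\to x^F}\frac{\varphi'(t)}{k(t)\,\varphi(t)}=0,\qquad \lim_{t\to x^F}\frac{\varphi''(t)}{k(t)\,\varphi'(t)}=0 .$$ Moreover, $F$ has penultimate tail behavior Fréchet if $\theta>1$ and penultimate tail behavior Weibull if $\theta<1$; that is, the penultimate tail index $\gamma_n=\varphi(H^{-1}(\log n))$ satisfies, for all sufficiently large $n$, $\gamma_n>0$ if $\theta>1$ and $\gamma_n<0$ if $\theta<1$.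
   Context: A function $l$ is slowly varying at infinity if $l(tx)/l(t)\to 1$ as $t\to\infty$ for every $x>0$. $H^{-1}$ denotes the generalized inverse of $H$, $H^{-1}(t)=\inf\{x\ge x_0: H(x)\ge t\}$ (equivalently to $H(x)=x^{1/\theta}l(x)$, one has $H^{-1}(x)=x^{\theta}l^*(x)$ with $l^*$ slowly varying). For $\gamma\in\mathbb{R}$, the generalized extreme value distribution is $G_\gamma(x)=\exp(-(1+\gamma x)^{-1/\gamma})$ for $1+\gamma x>0$, with $G_0(x)=\exp(-e^{-x})$; $\gamma>0$ is the Fréchet type, $\gamma<0$ the Weibull type and $\gamma=0$ the Gumbel type. Weibull-type distributions belong to the Gumbel max-domain of attraction. With $b_n=H^{-1}(\log n)$ and $a_n=1/k(b_n)$, the penultimate approximation replaces the limit law $G_0$ of $F^n(a_nx+b_n)$ by the sequence $G_{\gamma_n}$, where the penultimate tail index is $$\gamma_n=\gamma(\log n)=-\frac{k'(b_n)}{(k(b_n))^2},\qquad \gamma(t)=\varphi(H^{-1}(t)).$$ The penultimate tail behavior is called Fréchet (respectively Weibull) when $\gamma_n>0$ (respectively $\gamma_n<0$) for all sufficiently large $n$. *)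

theory Defs
  imports "HOL-Probability.Probability"
begin

definition slowly_varying :: "(real \<Rightarrow> real) \<Rightarrow> bool" where
  "slowly_varying l \<longleftrightarrow> (\<forall>x>0. ((\<lambda>t. l (t * x) / l t) \<longlongrightarrow> 1) at_top)"

definition distribution_function :: "(real \<Rightarrow> real) \<Rightarrow> bool" where
  "distribution_function F \<longleftrightarrow> (\<exists>M. real_distribution M \<and> F = cdf M)"

definition weibull_H :: "real \<Rightarrow> (real \<Rightarrow> real) \<Rightarrow> real \<Rightarrow> real" where
  "weibull_H \<theta> l x = x powr (1 / \<theta>) * l x"

text \<open>The function \<open>l\<close> matters only on \<open>[x0, \<infinity>)\<close>; its values elsewhere are unconstrained.\<close>

definition weibull_type ::
  "real \<Rightarrow> (real \<Rightarrow> real) \<Rightarrow> real \<Rightarrow> (real \<Rightarrow> real) \<Rightarrow> bool" where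
  "weibull_type \<theta> l x0 F \<longleftrightarrow>
     distribution_function F \<and> 0 < \<theta> \<and> 0 \<le> x0 \<and>
     slowly_varying l \<and> (\<forall>x\<ge>x0. 0 < l x) \<and>
     (\<forall>x\<ge>x0. 1 - F x = exp (- weibull_H \<theta> l x))"

definition generalized_inverse :: "(real \<Rightarrow> real) \<Rightarrow> real \<Rightarrow> real \<Rightarrow> real" where
  "generalized_inverse H x0 t = Inf {x. x0 \<le> x \<and> t \<le> H x}"

definition right_endpoint :: "(real \<Rightarrow> real) \<Rightarrow> ereal" where
  "right_endpoint F = Sup (ereal ` {x. F x < 1})"

text \<open>The filter of real \<open>t\<close> tending to the right endpoint of \<open>F\<close> from below,
  whether that endpoint is finite or \<open>\<infinity>\<close>.\<close>

definition to_right_endpoint :: "(real \<Rightarrow> real) \<Rightarrow> real filter" where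
  "to_right_endpoint F = filtercomap ereal (at_left (right_endpoint F))"

lemma filtercomap_ereal_filtermap: "filtercomap ereal (filtermap ereal G) = G"
proof (rule filter_eqI)
  fix P
  show "eventually P (filtercomap ereal (filtermap ereal G)) = eventually P G"
  proof
    assume "eventually P (filtercomap ereal (filtermap ereal G))"
    then obtain Q where "\<forall>\<^sub>F x in G. Q (ereal x)" and "\<forall>x. Q (ereal x) \<longrightarrow> P x"
      by (auto simp: eventually_filtercomap eventually_filtermap)
    then show "eventually P G"
      by (auto elim: eventually_mono)
  next
    assume "eventually P G"
    then show "eventually P (filtercomap ereal (filtermap ereal G))"
      unfolding eventually_filtercomap eventually_filtermap
      by (intro exI[of _ "\<lambda>y. P (real_of_ereal y)"]) simp
  qed
qed

lemma to_right_endpoint_PInf: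
  assumes "right_endpoint F = \<infinity>"
  shows "to_right_endpoint F = at_top"
  unfolding to_right_endpoint_def assms at_left_PInf
  by (rule filtercomap_ereal_filtermap)

lemma to_right_endpoint_real:
  assumes "right_endpoint F = ereal b"
  shows "to_right_endpoint F = at_left b"
  unfolding to_right_endpoint_def assms at_left_ereal
  by (rule filtercomap_ereal_filtermap)

definition vm_k :: "(real \<Rightarrow> real) \<Rightarrow> real \<Rightarrow> real" where
  "vm_k F = deriv (\<lambda>x. - ln (- ln (F x)))"

definition vm_phi :: "(real \<Rightarrow> real) \<Rightarrow> real \<Rightarrow> real" where
  "vm_phi F = deriv (\<lambda>x. 1 / vm_k F x)"

lemma vm_phi_eq:
  assumes "vm_k F differentiable (at x)" and "vm_k F x \<noteq> 0"
  shows "vm_phi F x = - deriv (vm_k F) x / (vm_k F x)\<^sup>2"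
proof -
  have "(vm_k F has_real_derivative deriv (vm_k F) x) (at x)"
    using assms(1) DERIV_imp_deriv real_differentiableE by metis
  then have "((\<lambda>x. 1 / vm_k F x) has_real_derivative
      (0 * vm_k F x - 1 * deriv (vm_k F) x) / (vm_k F x * vm_k F x)) (at x)"
    using assms(2) by (intro DERIV_divide DERIV_const)
  then show ?thesis
    unfolding vm_phi_def by (simp add: DERIV_imp_deriv power2_eq_square)
qed

text \<open>Since \<open>deriv\<close>, \<open>ln\<close> and division are total functions, each condition states, besides the
  limit, that all expressions in it are meaningful close to the right endpoint.\<close>

definition von_mises_first_order :: "(real \<Rightarrow> real) \<Rightarrow> bool" where
  "von_mises_first_order F \<longleftrightarrow>
     (\<forall>\<^sub>F t in to_right_endpoint F.
        0 < F t \<and> F t < 1 \<and> (\<lambda>x. - ln (- ln (F x))) differentiable (at t) \<and>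
        vm_k F differentiable (at t) \<and> vm_k F t \<noteq> 0) \<and>
     (vm_phi F \<longlongrightarrow> 0) (to_right_endpoint F)"

definition von_mises_second_order :: "(real \<Rightarrow> real) \<Rightarrow> bool" where
  "von_mises_second_order F \<longleftrightarrow>
     (\<forall>\<^sub>F t in to_right_endpoint F. vm_phi F differentiable (at t) \<and> vm_phi F t \<noteq> 0) \<and>
     ((\<lambda>t. deriv (vm_phi F) t / (vm_k F t * vm_phi F t)) \<longlongrightarrow> 0) (to_right_endpoint F)"

definition von_mises_penultimate :: "(real \<Rightarrow> real) \<Rightarrow> bool" where
  "von_mises_penultimate F \<longleftrightarrow>
     (\<forall>\<^sub>F t in to_right_endpoint F.
        deriv (vm_phi F) differentiable (at t) \<and> deriv (vm_phi F) t \<noteq> 0) \<and>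
     ((\<lambda>t. deriv (deriv (vm_phi F)) t / (vm_k F t * deriv (vm_phi F) t)) \<longlongrightarrow> 0)
       (to_right_endpoint F)"

definition penultimate_index ::
  "(real \<Rightarrow> real) \<Rightarrow> (real \<Rightarrow> real) \<Rightarrow> real \<Rightarrow> nat \<Rightarrow> real" where
  "penultimate_index F H x0 n = vm_phi F (generalized_inverse H x0 (ln (real n)))"

definition penultimate_frechet ::
  "(real \<Rightarrow> real) \<Rightarrow> (real \<Rightarrow> real) \<Rightarrow> real \<Rightarrow> bool" where
  "penultimate_frechet F H x0 \<longleftrightarrow> (\<forall>\<^sub>F n in sequentially. 0 < penultimate_index F H x0 n)"

definition penultimate_weibull ::
  "(real \<Rightarrow> real) \<Rightarrow> (real \<Rightarrow> real) \<Rightarrow> real \<Rightarrow> bool" where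
  "penultimate_weibull F H x0 \<longleftrightarrow> (\<forall>\<^sub>F n in sequentially. penultimate_index F H x0 n < 0)"

end

theory Submission
  imports Defs "HOL-Real_Asymp.Real_Asymp"
begin

text \<open>Write \<open>u y = (exp y - 1) * (- ln (1 - exp (- y)))\<close>. Then \<open>1 / k = u H / H'\<close>, and \<open>u\<close> differs
  from \<open>1\<close> by a term that is exponentially small together with its derivatives. With \<open>a = 1 / \<theta>\<close> the
  hypotheses on \<open>l\<close> give that \<open>x ^ j * H\<^sup>(\<^sup>j\<^sup>) / H\<close> tends to the falling factorial \<open>a (a - 1) \<dots> (a - j + 1)\<close>
  for \<open>j \<le> 4\<close>, so that \<open>H * \<phi>\<close>, \<open>x * H * \<phi>'\<close> and \<open>x\<^sup>2 * H * \<phi>''\<close> converge to \<open>(1 - a) / a\<close>, \<open>a - 1\<close>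
  and \<open>1 - a\<^sup>2\<close>. The first two limits are nonzero for \<open>a \<noteq> 1\<close>, and \<open>x * k / H\<close> tends to \<open>a\<close>;
  hence all three von Mises quotients are \<open>O(1 / H)\<close>, and \<open>\<phi>\<close> has the sign of \<open>1 - a\<close>.\<close>

section \<open>The correction factor \<open>u\<close> and its derivatives\<close>

definition gumbel_u :: "real \<Rightarrow> real" where
  "gumbel_u y = (exp y - 1) * (- ln (1 - exp (- y)))"

text \<open>Here and in \<open>gumbel_u2\<close>, \<open>gumbel_u3\<close> the term
  \<open>- exp y * ln (1 - exp (- y))\<close> equals \<open>1 + exp (- y) / 2 + ...\<close> for
  \<open>y > 0\<close>. The remaining summands cancel its constant \<open>1\<close>, so these
  derivatives of \<open>gumbel_u\<close> are of order \<open>exp (- y)\<close>.\<close>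

definition gumbel_u1 :: "real \<Rightarrow> real" where
  "gumbel_u1 y = - exp y * ln (1 - exp (- y)) - 1"

definition gumbel_u2 :: "real \<Rightarrow> real" where
  "gumbel_u2 y = - exp y * ln (1 - exp (- y)) - exp y / (exp y - 1)"

definition gumbel_u3 :: "real \<Rightarrow> real" where
  "gumbel_u3 y = - exp y * ln (1 - exp (- y)) - exp y / (exp y - 1) + exp y / (exp y - 1)\<^sup>2"

lemma exp_minus_quotient:
  fixes y :: real
  assumes "y > 0"
  shows "exp (- y) / (1 - exp (- y)) = 1 / (exp y - 1)"
  using assms by (simp add: exp_minus field_simps)

lemma DERIV_ln_one_minus_exp:
  fixes y :: real
  assumes "y > 0"
  shows "((\<lambda>y. ln (1 - exp (- y))) has_real_derivative 1 / (exp y - 1)) (at y)"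
  by (rule derivative_eq_intros refl | use assms exp_minus_quotient[OF assms] in simp)+

lemma DERIV_gumbel_u:
  assumes "y > 0"
  shows "(gumbel_u has_real_derivative gumbel_u1 y) (at y)"
proof -
  have "(gumbel_u has_real_derivative
      exp y * - ln (1 - exp (- y)) + - (1 / (exp y - 1)) * (exp y - 1)) (at y)"
    unfolding gumbel_u_def
    by (intro DERIV_mult DERIV_minus DERIV_ln_one_minus_exp assms)
      (auto intro!: derivative_eq_intros)
  then show ?thesis
    using assms by (simp add: gumbel_u1_def)
qed

lemma DERIV_gumbel_u1:
  assumes "y > 0"
  shows "(gumbel_u1 has_real_derivative gumbel_u2 y) (at y)"
  unfolding gumbel_u1_def gumbel_u2_def
  using assms by (auto intro!: derivative_eq_intros DERIV_ln_one_minus_exp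
      simp: field_simps exp_minus_inverse)

lemma DERIV_gumbel_u2:
  assumes "y > 0"
  shows "(gumbel_u2 has_real_derivative gumbel_u3 y) (at y)"
proof -
  have "exp y \<noteq> 1"
    using assms by simp
  then show ?thesis
    unfolding gumbel_u2_def gumbel_u3_def
    by (auto intro!: derivative_eq_intros DERIV_ln_one_minus_exp assms
        simp: field_simps power2_eq_square exp_minus_inverse)
qed

lemma gumbel_u_pos:
  assumes "y > 0"
  shows "gumbel_u y > 0"
  unfolding gumbel_u_def using assms by (intro mult_pos_pos) auto

lemma tendsto_gumbel_u: "(gumbel_u \<longlongrightarrow> 1) at_top"
  unfolding gumbel_u_def by real_asymp

text \<open>The powers of \<open>y\<close> here and in the next two lemmas are those of
  \<open>H\<close> that accompany \<open>gumbel_u1\<close>, \<open>gumbel_u2\<close>,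
  \<open>gumbel_u3\<close> in the rescaled \<open>phi\<close>, \<open>phi1\<close>,
  \<open>phi2\<close>.\<close>

lemma tendsto_gumbel_u1: "((\<lambda>y. gumbel_u1 y * y) \<longlongrightarrow> 0) at_top"
  unfolding gumbel_u1_def by real_asymp

lemma tendsto_gumbel_u2: "((\<lambda>y. gumbel_u2 y * y ^ 2) \<longlongrightarrow> 0) at_top"
  unfolding gumbel_u2_def by real_asymp

lemma tendsto_gumbel_u3: "((\<lambda>y. gumbel_u3 y * y ^ 3) \<longlongrightarrow> 0) at_top"
  unfolding gumbel_u3_def by real_asymp

section \<open>Tails \<open>exp (- H)\<close> with a smooth, asymptotically power-like
  \<open>H\<close>\<close>

text \<open>Isolates what the argument needs of \<open>H\<close>, without reference to
  \<open>l\<close>. The limits \<open>lim_H1\<close> to \<open>lim_H4\<close> are the exact values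
  for \<open>H x = x powr a\<close>.\<close>

locale smooth_tail =
  fixes F H H1 H2 H3 H4 :: "real \<Rightarrow> real" and a X :: real
  assumes a_pos: "a > 0" and a_neq_1: "a \<noteq> 1"
    and F_eq: "\<And>x. x > X \<Longrightarrow> F x = 1 - exp (- H x)"
    and H_pos: "\<And>x. x > X \<Longrightarrow> H x > 0"
    and H1_pos: "\<And>x. x > X \<Longrightarrow> H1 x > 0"
    and DERIV_H: "\<And>x. x > X \<Longrightarrow> (H has_real_derivative H1 x) (at x)"
    and DERIV_H1: "\<And>x. x > X \<Longrightarrow> (H1 has_real_derivative H2 x) (at x)"
    and DERIV_H2: "\<And>x. x > X \<Longrightarrow> (H2 has_real_derivative H3 x) (at x)"
    and DERIV_H3: "\<And>x. x > X \<Longrightarrow> (H3 has_real_derivative H4 x) (at x)"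
    and H_at_top: "filterlim H at_top at_top"
    and lim_H1: "((\<lambda>x. x * H1 x / H x) \<longlongrightarrow> a) at_top"
    and lim_H2: "((\<lambda>x. x ^ 2 * H2 x / H x) \<longlongrightarrow> a * (a - 1)) at_top"
    and lim_H3: "((\<lambda>x. x ^ 3 * H3 x / H x) \<longlongrightarrow> a * (a - 1) * (a - 2)) at_top"
    and lim_H4: "((\<lambda>x. x ^ 4 * H4 x / H x) \<longlongrightarrow> a * (a - 1) * (a - 2) * (a - 3)) at_top"
begin

text \<open>The first three derivatives of \<open>1 / H'\<close>.\<close>

definition w1 :: "real \<Rightarrow> real" where
  "w1 x = - H2 x / H1 x ^ 2"

definition w2 :: "real \<Rightarrow> real" where
  "w2 x = - H3 x / H1 x ^ 2 + 2 * H2 x ^ 2 / H1 x ^ 3"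

definition w3 :: "real \<Rightarrow> real" where
  "w3 x = - H4 x / H1 x ^ 2 + 6 * H2 x * H3 x / H1 x ^ 3 - 6 * H2 x ^ 3 / H1 x ^ 4"

text \<open>Closed form of the derivative of \<open>1 / k = gumbel_u (H x) * (1 / H1 x)\<close>. The
  chain rule factor \<open>H1 x\<close> cancels against \<open>1 / H1 x\<close> in the first
  summand.\<close>

definition phi :: "real \<Rightarrow> real" where
  "phi x = gumbel_u1 (H x) + gumbel_u (H x) * w1 x"

definition phi1 :: "real \<Rightarrow> real" where
  "phi1 x = gumbel_u2 (H x) * H1 x + gumbel_u1 (H x) * H1 x * w1 x + gumbel_u (H x) * w2 x"

definition phi2 :: "real \<Rightarrow> real" where
  "phi2 x = gumbel_u3 (H x) * H1 x ^ 2 + gumbel_u2 (H x) * H2 x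
     + gumbel_u2 (H x) * H1 x ^ 2 * w1 x + gumbel_u1 (H x) * H2 x * w1 x
     + 2 * gumbel_u1 (H x) * H1 x * w2 x + gumbel_u (H x) * w3 x"

lemma DERIV_inverse_H1:
  assumes "x > X"
  shows "((\<lambda>x. 1 / H1 x) has_real_derivative w1 x) (at x)"
  unfolding w1_def using H1_pos[OF assms]
  by (auto intro!: derivative_eq_intros DERIV_H1 assms simp: field_simps power2_eq_square)

lemma DERIV_w1:
  assumes "x > X"
  shows "(w1 has_real_derivative w2 x) (at x)"
  unfolding w1_def w2_def using H1_pos[OF assms]
  by (auto intro!: derivative_eq_intros DERIV_H1 DERIV_H2 assms
      simp: divide_simps) (simp add: algebra_simps eval_nat_numeral)

lemma DERIV_w2:
  assumes "x > X"
  shows "(w2 has_real_derivative w3 x) (at x)"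
  unfolding w2_def w3_def using H1_pos[OF assms]
  by (auto intro!: derivative_eq_intros DERIV_H1 DERIV_H2 DERIV_H3 assms)
    (simp add: field_simps eval_nat_numeral)

lemma DERIV_gumbel_H:
  assumes "x > X"
  shows "((\<lambda>x. gumbel_u (H x)) has_real_derivative gumbel_u1 (H x) * H1 x) (at x)"
    and "((\<lambda>x. gumbel_u1 (H x)) has_real_derivative gumbel_u2 (H x) * H1 x) (at x)"
    and "((\<lambda>x. gumbel_u2 (H x)) has_real_derivative gumbel_u3 (H x) * H1 x) (at x)"
  using DERIV_chain2[OF DERIV_gumbel_u DERIV_H] DERIV_chain2[OF DERIV_gumbel_u1 DERIV_H]
    DERIV_chain2[OF DERIV_gumbel_u2 DERIV_H] H_pos[OF assms] assms by auto

lemma DERIV_inverse_k: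
  assumes "x > X"
  shows "((\<lambda>x. gumbel_u (H x) * (1 / H1 x)) has_real_derivative phi x) (at x)"
  using DERIV_mult[OF DERIV_gumbel_H(1) DERIV_inverse_H1, OF assms assms] H1_pos[OF assms]
  by (simp add: phi_def mult.commute)

lemma DERIV_phi:
  assumes "x > X"
  shows "(phi has_real_derivative phi1 x) (at x)"
  unfolding phi_def phi1_def
  by (auto intro!: derivative_eq_intros DERIV_gumbel_H DERIV_w1 assms simp: algebra_simps)

lemma DERIV_phi1:
  assumes "x > X"
  shows "(phi1 has_real_derivative phi2 x) (at x)"
  unfolding phi1_def phi2_def
  by (auto intro!: derivative_eq_intros DERIV_gumbel_H DERIV_H1 DERIV_w1 DERIV_w2 assms
      simp: algebra_simps power2_eq_square)

text \<open>The closed forms agree with the \<open>deriv\<close> expressions only beyond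
  \<open>X\<close>. As \<open>{X<..}\<close> is open, this suffices to transfer derivatives.\<close>

lemma DERIV_transform:
  assumes "(g has_real_derivative d) (at x)" and "x > X" and "\<And>y. y > X \<Longrightarrow> g y = f y"
  shows "(f has_real_derivative d) (at x)"
  using has_field_derivative_transform_within_open[OF assms(1), of "{X<..}"] assms(2,3) by auto

text \<open>The origin of \<open>gumbel_u\<close>: the chain rule produces the denominator
  \<open>(exp (H x) - 1) * (- ln (1 - exp (- H x)))\<close>.\<close>

lemma DERIV_double_log:
  assumes "x > X"
  shows "((\<lambda>x. - ln (- ln (F x))) has_real_derivative H1 x / gumbel_u (H x)) (at x)"
proof (rule DERIV_transform[OF _ assms])
  have pos: "H x > 0"
    by (rule H_pos[OF assms])
  \<comment> \<open>Makes the argument of the outer logarithm positive.\<close>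
  have ln_neg: "ln (1 - exp (- H x)) < 0"
    using pos by simp
  have "((\<lambda>x. ln (1 - exp (- H x))) has_real_derivative 1 / (exp (H x) - 1) * H1 x) (at x)"
    by (rule DERIV_chain2[OF DERIV_ln_one_minus_exp[OF pos] DERIV_H[OF assms]])
  from DERIV_minus[OF DERIV_chain2[OF DERIV_ln DERIV_minus[OF this]]] ln_neg
  have "((\<lambda>x. - ln (- ln (1 - exp (- H x)))) has_real_derivative
      - (inverse (- ln (1 - exp (- H x))) * - (1 / (exp (H x) - 1) * H1 x))) (at x)"
    by simp
  then show "((\<lambda>x. - ln (- ln (1 - exp (- H x)))) has_real_derivative H1 x / gumbel_u (H x)) (at x)"
    by (rule DERIV_cong) (use ln_neg pos in \<open>simp add: gumbel_u_def divide_simps\<close>)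
qed (simp add: F_eq)

lemma vm_k: "x > X \<Longrightarrow> vm_k F x = H1 x / gumbel_u (H x)"
  unfolding vm_k_def by (rule DERIV_imp_deriv[OF DERIV_double_log])

lemma vm_phi: "x > X \<Longrightarrow> vm_phi F x = phi x"
  unfolding vm_phi_def
  by (rule DERIV_imp_deriv) (auto intro!: DERIV_transform[OF DERIV_inverse_k] simp: vm_k)

lemma DERIV_vm_phi: "x > X \<Longrightarrow> (vm_phi F has_real_derivative phi1 x) (at x)"
  by (rule DERIV_transform[OF DERIV_phi]) (auto simp: vm_phi)

lemma deriv_vm_phi: "x > X \<Longrightarrow> deriv (vm_phi F) x = phi1 x"
  by (rule DERIV_imp_deriv[OF DERIV_vm_phi])

lemma DERIV_deriv_vm_phi: "x > X \<Longrightarrow> (deriv (vm_phi F) has_real_derivative phi2 x) (at x)"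
  by (rule DERIV_transform[OF DERIV_phi1]) (auto simp: deriv_vm_phi)

lemma deriv_deriv_vm_phi: "x > X \<Longrightarrow> deriv (deriv (vm_phi F)) x = phi2 x"
  by (rule DERIV_imp_deriv[OF DERIV_deriv_vm_phi])

text \<open>The first order condition asks for differentiability of \<open>k\<close> itself, not
  only of \<open>1 / k\<close>.\<close>

lemma differentiable_vm_k:
  assumes "x > X"
  shows "vm_k F differentiable (at x)"
proof -
  have "((\<lambda>x. H1 x / gumbel_u (H x)) has_real_derivative
      (H2 x * gumbel_u (H x) - H1 x * (gumbel_u1 (H x) * H1 x)) / (gumbel_u (H x) * gumbel_u (H x))) (at x)"
    using gumbel_u_pos[OF H_pos[OF assms]]
    by (intro DERIV_divide DERIV_H1 DERIV_gumbel_H assms) auto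
  then have "(vm_k F has_real_derivative
      (H2 x * gumbel_u (H x) - H1 x * (gumbel_u1 (H x) * H1 x)) / (gumbel_u (H x) * gumbel_u (H x))) (at x)"
    by (rule DERIV_transform[OF _ assms]) (simp add: vm_k)
  then show ?thesis
    by (auto simp: real_differentiable_def)
qed

section \<open>Limits of the rescaled \<open>phi\<close>, \<open>phi1\<close> and
  \<open>phi2\<close>\<close>

text \<open>Taking \<open>max X 0\<close> makes \<open>x\<close> positive, so that powers of
  \<open>x\<close> can be cancelled in the identities below.\<close>

lemma eventually_beyond: "\<forall>\<^sub>F x in at_top. x > max X 0 \<and> H x > 0 \<and> H1 x > 0"
  using eventually_gt_at_top[of "max X 0"] by eventually_elim (auto simp: H_pos H1_pos)

lemma lim_w1: "((\<lambda>x. H x * w1 x) \<longlongrightarrow> (1 - a) / a) at_top"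
proof -
  have "((\<lambda>x. - (x ^ 2 * H2 x / H x) / (x * H1 x / H x) ^ 2) \<longlongrightarrow> - (a * (a - 1)) / a ^ 2) at_top"
    using a_pos by (intro tendsto_intros lim_H1 lim_H2) auto
  also have "- (a * (a - 1)) / a ^ 2 = (1 - a) / a"
    using a_pos by (simp add: field_simps power2_eq_square)
  finally show ?thesis
    by (rule Lim_transform_eventually)
      (use eventually_beyond in eventually_elim,
        simp add: w1_def field_simps eval_nat_numeral)
qed

text \<open>As for \<open>w1\<close> and \<open>w3\<close>, the rescaled quantity is a rational
  function of the ratios \<open>x ^ j * Hj / H\<close>. Its limit is therefore the value for the
  pure power, where \<open>1 / H1 x = x powr (1 - a) / a\<close>.\<close>

lemma lim_w2: "((\<lambda>x. x * H x * w2 x) \<longlongrightarrow> a - 1) at_top"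
proof -
  let ?p = "\<lambda>x. x * H1 x / H x" and ?q = "\<lambda>x. x ^ 2 * H2 x / H x" and ?r = "\<lambda>x. x ^ 3 * H3 x / H x"
  have "((\<lambda>x. - ?r x / ?p x ^ 2 + 2 * ?q x ^ 2 / ?p x ^ 3) \<longlongrightarrow>
      - (a * (a - 1) * (a - 2)) / a ^ 2 + 2 * (a * (a - 1)) ^ 2 / a ^ 3) at_top"
    using a_pos by (intro tendsto_intros lim_H1 lim_H2 lim_H3) auto
  also have "- (a * (a - 1) * (a - 2)) / a ^ 2 + 2 * (a * (a - 1)) ^ 2 / a ^ 3 = a - 1"
    using a_pos by (simp add: field_simps eval_nat_numeral)
  finally show ?thesis
    by (rule Lim_transform_eventually)
      (use eventually_beyond in eventually_elim,
        simp add: w2_def field_simps eval_nat_numeral)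
qed

lemma lim_w3: "((\<lambda>x. x ^ 2 * H x * w3 x) \<longlongrightarrow> 1 - a ^ 2) at_top"
proof -
  let ?p = "\<lambda>x. x * H1 x / H x" and ?q = "\<lambda>x. x ^ 2 * H2 x / H x"
    and ?r = "\<lambda>x. x ^ 3 * H3 x / H x" and ?s = "\<lambda>x. x ^ 4 * H4 x / H x"
  have "((\<lambda>x. - ?s x / ?p x ^ 2 + 6 * ?q x * ?r x / ?p x ^ 3 - 6 * ?q x ^ 3 / ?p x ^ 4) \<longlongrightarrow>
      - (a * (a - 1) * (a - 2) * (a - 3)) / a ^ 2 + 6 * (a * (a - 1)) * (a * (a - 1) * (a - 2)) / a ^ 3
      - 6 * (a * (a - 1)) ^ 3 / a ^ 4) at_top"
    using a_pos by (intro tendsto_intros lim_H1 lim_H2 lim_H3 lim_H4) auto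
  also have "- (a * (a - 1) * (a - 2) * (a - 3)) / a ^ 2
      + 6 * (a * (a - 1)) * (a * (a - 1) * (a - 2)) / a ^ 3 - 6 * (a * (a - 1)) ^ 3 / a ^ 4 = 1 - a ^ 2"
    using a_pos by (simp add: field_simps eval_nat_numeral)
  finally show ?thesis
    by (rule Lim_transform_eventually)
      (use eventually_beyond in eventually_elim,
        simp add: w3_def field_simps eval_nat_numeral)
qed

lemmas lim_gumbel_u_H = filterlim_compose[OF tendsto_gumbel_u H_at_top]
lemmas lim_gumbel_u1_H = filterlim_compose[OF tendsto_gumbel_u1 H_at_top]
lemmas lim_gumbel_u2_H = filterlim_compose[OF tendsto_gumbel_u2 H_at_top]
lemmas lim_gumbel_u3_H = filterlim_compose[OF tendsto_gumbel_u3 H_at_top]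

text \<open>The exponentially small \<open>gumbel_u1\<close> beats the factor \<open>H\<close>, and
  \<open>gumbel_u\<close> tends to \<open>1\<close>, so only the contribution of \<open>w1\<close>
  survives.\<close>

lemma lim_phi: "((\<lambda>x. H x * phi x) \<longlongrightarrow> (1 - a) / a) at_top"
proof -
  have "((\<lambda>x. gumbel_u1 (H x) * H x + gumbel_u (H x) * (H x * w1 x)) \<longlongrightarrow>
      0 + 1 * ((1 - a) / a)) at_top"
    by (intro tendsto_intros lim_gumbel_u_H lim_gumbel_u1_H lim_w1)
  then show ?thesis
    by (simp add: phi_def algebra_simps)
qed

lemma lim_phi1: "((\<lambda>x. x * H x * phi1 x) \<longlongrightarrow> a - 1) at_top"
proof -
  let ?p = "\<lambda>x. x * H1 x / H x"
  \<comment> \<open>Each \<open>H1 x\<close> is written as \<open>?p x * H x / x\<close>. The freed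
    powers of \<open>H\<close> go to the derivatives of \<open>gumbel_u\<close>, whose summands then
    vanish.\<close>
  have "((\<lambda>x. gumbel_u2 (H x) * H x ^ 2 * ?p x + gumbel_u1 (H x) * H x * ?p x * (H x * w1 x)
      + gumbel_u (H x) * (x * H x * w2 x)) \<longlongrightarrow> 0 * a + 0 * a * ((1 - a) / a) + 1 * (a - 1)) at_top"
    by (intro tendsto_add tendsto_mult lim_gumbel_u_H lim_gumbel_u1_H lim_gumbel_u2_H
        lim_w1 lim_w2 lim_H1)
  also have "0 * a + 0 * a * ((1 - a) / a) + 1 * (a - 1) = a - 1"
    by simp
  finally show ?thesis
    by (rule Lim_transform_eventually)
      (use eventually_beyond in eventually_elim,
        simp add: phi1_def field_simps eval_nat_numeral)
qed

lemma lim_phi2: "((\<lambda>x. x ^ 2 * H x * phi2 x) \<longlongrightarrow> 1 - a ^ 2) at_top"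
proof -
  let ?p = "\<lambda>x. x * H1 x / H x" and ?q = "\<lambda>x. x ^ 2 * H2 x / H x"
  have "((\<lambda>x. gumbel_u3 (H x) * H x ^ 3 * (?p x * ?p x) + gumbel_u2 (H x) * H x ^ 2 * ?q x
      + gumbel_u2 (H x) * H x ^ 2 * (?p x * ?p x) * (H x * w1 x)
      + gumbel_u1 (H x) * H x * ?q x * (H x * w1 x)
      + 2 * (gumbel_u1 (H x) * H x) * ?p x * (x * H x * w2 x)
      + gumbel_u (H x) * (x ^ 2 * H x * w3 x)) \<longlongrightarrow>
      0 * (a * a) + 0 * (a * (a - 1)) + 0 * (a * a) * ((1 - a) / a)
      + 0 * (a * (a - 1)) * ((1 - a) / a) + 2 * 0 * a * (a - 1) + 1 * (1 - a ^ 2)) at_top"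
    by (intro tendsto_add tendsto_mult tendsto_const lim_gumbel_u_H lim_gumbel_u1_H lim_gumbel_u2_H
        lim_gumbel_u3_H lim_w1 lim_w2 lim_w3 lim_H1 lim_H2)
  also have "0 * (a * a) + 0 * (a * (a - 1)) + 0 * (a * a) * ((1 - a) / a)
      + 0 * (a * (a - 1)) * ((1 - a) / a) + 2 * 0 * a * (a - 1) + 1 * (1 - a ^ 2) = 1 - a ^ 2"
    by simp
  finally show ?thesis
    by (rule Lim_transform_eventually)
      (use eventually_beyond in eventually_elim,
        simp add: phi2_def field_simps eval_nat_numeral)
qed

lemma lim_k: "((\<lambda>x. x * vm_k F x / H x) \<longlongrightarrow> a) at_top"
proof -
  have "((\<lambda>x. (x * H1 x / H x) / gumbel_u (H x)) \<longlongrightarrow> a / 1) at_top"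
    by (intro tendsto_divide lim_H1 lim_gumbel_u_H) auto
  then have "((\<lambda>x. (x * H1 x / H x) / gumbel_u (H x)) \<longlongrightarrow> a) at_top"
    by simp
  then show ?thesis
    by (rule Lim_transform_eventually) (use eventually_beyond in eventually_elim, simp add: vm_k)
qed

lemma inverse_H: "((\<lambda>x. inverse (H x)) \<longlongrightarrow> 0) at_top"
  using H_at_top by (rule tendsto_inverse_0_at_top)

text \<open>This is where \<open>a_neq_1\<close> enters: it keeps the denominators of the last two
  von Mises quotients away from zero after rescaling.\<close>

lemma phi_limit_nonzero: "(1 - a) / a \<noteq> 0" "a - 1 \<noteq> 0"
  using a_pos a_neq_1 by auto

lemma eventually_phi_nonzero: "\<forall>\<^sub>F x in at_top. phi x \<noteq> 0" "\<forall>\<^sub>F x in at_top. phi1 x \<noteq> 0"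
  using tendsto_imp_eventually_ne[OF lim_phi phi_limit_nonzero(1)]
    tendsto_imp_eventually_ne[OF lim_phi1 phi_limit_nonzero(2)]
  by (auto elim: eventually_mono)

section \<open>The von Mises conditions and the sign of \<open>phi\<close>\<close>

lemma right_endpoint: "right_endpoint F = \<infinity>"
  unfolding right_endpoint_def
proof (rule Sup_eqI)
  fix y :: ereal
  assume upper: "\<And>x. x \<in> ereal ` {x. F x < 1} \<Longrightarrow> x \<le> y"
  show "\<infinity> \<le> y"
  proof (rule ccontr)
    assume "\<not> \<infinity> \<le> y"
    then obtain r where "y < ereal r"
      using ereal_dense2[of y \<infinity>] by (auto simp: not_le)
    \<comment> \<open>A point no smaller than \<open>r\<close> that also lies beyond
      \<open>X\<close>, where the formula for \<open>F\<close> is valid.\<close>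
    moreover have "F (max r (X + 1)) < 1"
      by (simp add: F_eq less_max_iff_disj)
    then have "ereal (max r (X + 1)) \<le> y"
      by (intro upper imageI) simp
    ultimately show False
      by (metis ereal_less_eq(3) leD max.cobounded1 order_trans)
  qed
qed simp

lemmas to_right_endpoint = to_right_endpoint_PInf[OF right_endpoint]

lemma von_mises_first_order: "von_mises_first_order F"
  unfolding von_mises_first_order_def to_right_endpoint
proof
  show "\<forall>\<^sub>F t in at_top. 0 < F t \<and> F t < 1 \<and> (\<lambda>x. - ln (- ln (F x))) differentiable (at t) \<and>
      vm_k F differentiable (at t) \<and> vm_k F t \<noteq> 0"
    using eventually_beyond
  proof eventually_elim
    case (elim t)
    then have "gumbel_u (H t) > 0"
      by (simp add: gumbel_u_pos)
    moreover have "(\<lambda>x. - ln (- ln (F x))) differentiable (at t)"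
      using elim DERIV_double_log[of t] by (auto simp: real_differentiable_def)
    ultimately show ?case
      using elim by (simp add: F_eq differentiable_vm_k vm_k)
  qed
  have "((\<lambda>x. H x * phi x * inverse (H x)) \<longlongrightarrow> (1 - a) / a * 0) at_top"
    by (intro tendsto_mult lim_phi inverse_H)
  then have "((\<lambda>x. H x * phi x * inverse (H x)) \<longlongrightarrow> 0) at_top"
    by simp
  then show "(vm_phi F \<longlongrightarrow> 0) at_top"
    by (rule Lim_transform_eventually)
      (use eventually_beyond in eventually_elim, simp add: vm_phi)
qed

lemma von_mises_second_order: "von_mises_second_order F"
  unfolding von_mises_second_order_def to_right_endpoint
proof
  show "\<forall>\<^sub>F t in at_top. vm_phi F differentiable (at t) \<and> vm_phi F t \<noteq> 0"
    using eventually_beyond eventually_phi_nonzero(1)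
    by eventually_elim (auto simp: vm_phi real_differentiable_def intro: DERIV_vm_phi)
  \<comment> \<open>All weights cancel except one surplus \<open>H x\<close> in the rescaled
    quotient. The inverse factor removes it and forces the limit \<open>0\<close>.\<close>
  have "((\<lambda>x. (x * H x * phi1 x) / ((x * vm_k F x / H x) * (H x * phi x)) * inverse (H x)) \<longlongrightarrow>
      (a - 1) / (a * ((1 - a) / a)) * 0) at_top"
    using a_pos phi_limit_nonzero
    by (intro tendsto_mult tendsto_divide lim_phi lim_phi1 lim_k inverse_H) auto
  then have "((\<lambda>x. (x * H x * phi1 x) / ((x * vm_k F x / H x) * (H x * phi x)) * inverse (H x)) \<longlongrightarrow> 0) at_top"
    by simp
  then show "((\<lambda>t. deriv (vm_phi F) t / (vm_k F t * vm_phi F t)) \<longlongrightarrow> 0) at_top"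
    by (rule Lim_transform_eventually)
      (use eventually_beyond in eventually_elim, simp add: vm_phi deriv_vm_phi field_simps)
qed

lemma von_mises_penultimate: "von_mises_penultimate F"
  unfolding von_mises_penultimate_def to_right_endpoint
proof
  show "\<forall>\<^sub>F t in at_top. deriv (vm_phi F) differentiable (at t) \<and> deriv (vm_phi F) t \<noteq> 0"
    using eventually_beyond eventually_phi_nonzero(2)
    by eventually_elim (auto simp: deriv_vm_phi real_differentiable_def intro: DERIV_deriv_vm_phi)
  have "((\<lambda>x. (x ^ 2 * H x * phi2 x) / ((x * vm_k F x / H x) * (x * H x * phi1 x)) * inverse (H x)) \<longlongrightarrow>
      (1 - a ^ 2) / (a * (a - 1)) * 0) at_top"
    using a_pos phi_limit_nonzero
    by (intro tendsto_mult tendsto_divide lim_phi1 lim_phi2 lim_k inverse_H) auto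
  then have "((\<lambda>x. (x ^ 2 * H x * phi2 x) / ((x * vm_k F x / H x) * (x * H x * phi1 x)) * inverse (H x)) \<longlongrightarrow> 0) at_top"
    by simp
  then show "((\<lambda>t. deriv (deriv (vm_phi F)) t / (vm_k F t * deriv (vm_phi F) t)) \<longlongrightarrow> 0) at_top"
    by (rule Lim_transform_eventually)
      (use eventually_beyond in eventually_elim,
        simp add: deriv_vm_phi deriv_deriv_vm_phi field_simps power2_eq_square)
qed

lemma eventually_vm_phi_pos:
  assumes "a < 1"
  shows "\<forall>\<^sub>F x in at_top. vm_phi F x > 0"
proof -
  have "\<forall>\<^sub>F x in at_top. H x * phi x > 0"
    using assms a_pos by (intro order_tendstoD(1)[OF lim_phi]) simp
  with eventually_beyond show ?thesis
    by eventually_elim (auto simp: vm_phi zero_less_mult_iff)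
qed

lemma eventually_vm_phi_neg:
  assumes "a > 1"
  shows "\<forall>\<^sub>F x in at_top. vm_phi F x < 0"
proof -
  have "\<forall>\<^sub>F x in at_top. H x * phi x < 0"
    using assms a_pos by (intro order_tendstoD(2)[OF lim_phi]) (simp add: field_simps)
  with eventually_beyond show ?thesis
    by eventually_elim (auto simp: vm_phi mult_less_0_iff)
qed

end

section \<open>The generalized inverse and the growth of \<open>H\<close>\<close>

text \<open>Once \<open>t\<close> exceeds \<open>H (max Z x0)\<close>, monotonicity makes
  \<open>Z\<close> a lower bound of the set whose infimum is taken. The maximum with
  \<open>x0\<close> stays in the range where \<open>H\<close> is monotone.\<close>

lemma generalized_inverse_at_top:
  assumes mono: "mono_on {x0..} H" and lim: "filterlim H at_top at_top"
  shows "filterlim (generalized_inverse H x0) at_top at_top"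
  unfolding filterlim_at_top
proof
  fix Z :: real
  have "\<forall>\<^sub>F t in at_top. t > H (max Z x0)"
    by (rule eventually_gt_at_top)
  then show "\<forall>\<^sub>F t in at_top. Z \<le> generalized_inverse H x0 t"
  proof eventually_elim
    case (elim t)
    \<comment> \<open>Nonemptiness of the set, without which a real \<open>Inf\<close> carries no
      information.\<close>
    have "\<forall>\<^sub>F x in at_top. x \<ge> x0 \<and> H x \<ge> t"
      using lim by (auto simp: filterlim_at_top intro: eventually_conj eventually_ge_at_top)
    then obtain x where "x \<ge> x0 \<and> H x \<ge> t"
      by (auto dest: eventually_happens)
    moreover have "Z \<le> y" if "x0 \<le> y" "t \<le> H y" for y
    proof (rule ccontr)
      assume "\<not> Z \<le> y"
      then have "H y \<le> H (max Z x0)"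
        using that by (intro mono_onD[OF mono]) auto
      then show False
        using that elim by simp
    qed
    ultimately show ?case
      unfolding generalized_inverse_def by (intro cInf_greatest) auto
  qed
qed

lemma generalized_inverse_ln_at_top:
  assumes "mono_on {x0..} H" and "filterlim H at_top at_top"
  shows "filterlim (\<lambda>n. generalized_inverse H x0 (ln (real n))) at_top sequentially"
  by (rule filterlim_compose[OF generalized_inverse_at_top[OF assms]
        filterlim_compose[OF ln_at_top filterlim_real_sequentially]])

text \<open>Both facts come from \<open>F\<close> being a distribution function:
  \<open>exp (- H)\<close> equals \<open>1 - F\<close> on \<open>{x0..}\<close>, which is
  nonincreasing and tends to \<open>0\<close>.\<close>

lemma weibull_type_H:
  assumes "weibull_type \<theta> l x0 F"
  shows "mono_on {x0..} (weibull_H \<theta> l)" and "filterlim (weibull_H \<theta> l) at_top at_top"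
proof -
  from assms obtain M where M: "real_distribution M" "F = cdf M"
    by (auto simp: weibull_type_def distribution_function_def)
  interpret real_distribution M
    by (rule M(1))
  have tail: "1 - F x = exp (- weibull_H \<theta> l x)" if "x \<ge> x0" for x
    using assms that by (auto simp: weibull_type_def)
  show "mono_on {x0..} (weibull_H \<theta> l)"
  proof (rule mono_onI)
    fix r s
    assume "r \<in> {x0..}" "s \<in> {x0..}" "r \<le> s"
    then have "exp (- weibull_H \<theta> l s) \<le> exp (- weibull_H \<theta> l r)"
      using cdf_nondecreasing[of r s] by (simp flip: tail add: M(2))
    then show "weibull_H \<theta> l r \<le> weibull_H \<theta> l s"
      by simp
  qed
  have ev: "\<forall>\<^sub>F x in at_top. 1 - F x = exp (- weibull_H \<theta> l x)"
    using eventually_ge_at_top[of x0] by eventually_elim (rule tail)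
  have "((\<lambda>x. 1 - F x) \<longlongrightarrow> 1 - 1) at_top"
    unfolding M(2) by (intro tendsto_intros cdf_lim_at_top_prob)
  then have "((\<lambda>x. 1 - F x) \<longlongrightarrow> 0) at_top"
    by simp
  then have lim0: "((\<lambda>x. exp (- weibull_H \<theta> l x)) \<longlongrightarrow> 0) at_top"
    using ev by (rule Lim_transform_eventually)
  \<comment> \<open>Positivity of \<open>exp\<close> makes the approach to \<open>0\<close>
    one-sided, as \<open>ln_at_0\<close> requires.\<close>
  then have "filterlim (\<lambda>x. exp (- weibull_H \<theta> l x)) (at_right 0) at_top"
    by (simp add: filterlim_at)
  then have "filterlim (\<lambda>x. ln (exp (- weibull_H \<theta> l x))) at_bot at_top"
    by (rule filterlim_compose[OF ln_at_0])
  then show "filterlim (weibull_H \<theta> l) at_top at_top"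
    by (simp add: filterlim_uminus_at_top)
qed

section \<open>Weibull-type tails as an instance of \<open>smooth_tail\<close>\<close>

text \<open>The product rule for the shape shared by all summands of \<open>H1\<close>,
  \<open>H2\<close> and \<open>H3\<close> in the theorem.\<close>

lemma DERIV_powr_mult:
  assumes "x > 0" and "(g has_real_derivative d) (at x)"
  shows "((\<lambda>x. c * x powr p * g x) has_real_derivative
    c * p * x powr (p - 1) * g x + c * x powr p * d) (at x)"
  using assms by (auto intro!: derivative_eq_intros simp: algebra_simps)

theorem proposition2p1:
  fixes \<theta> x0 :: real and F l :: "real \<Rightarrow> real"
  assumes "0 < \<theta>" and "\<theta> \<noteq> 1"
    and "weibull_type \<theta> l x0 F"
    and "\<forall>\<^sub>F x in at_top. \<forall>j<4. (deriv ^^ j) l differentiable (at x)"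
    and "((\<lambda>x. x * deriv l x / l x) \<longlongrightarrow> 0) at_top"
    and "((\<lambda>x. x ^ 2 * (deriv ^^ 2) l x / l x) \<longlongrightarrow> 0) at_top"
    and "((\<lambda>x. x ^ 3 * (deriv ^^ 3) l x / l x) \<longlongrightarrow> 0) at_top"
    and "((\<lambda>x. x ^ 4 * (deriv ^^ 4) l x / l x) \<longlongrightarrow> 0) at_top"
  shows "von_mises_first_order F \<and> von_mises_second_order F \<and> von_mises_penultimate F \<and>
    (\<theta> > 1 \<longrightarrow> penultimate_frechet F (weibull_H \<theta> l) x0) \<and>
    (\<theta> < 1 \<longrightarrow> penultimate_weibull F (weibull_H \<theta> l) x0)"
proof -
  define a where "a = 1 / \<theta>"
  define L where "L j = (deriv ^^ j) l" for j :: nat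
  define H where "H = weibull_H \<theta> l"
  have H_eq: "H x = x powr a * l x" for x
    by (simp add: H_def weibull_H_def a_def)
  \<comment> \<open>Leibniz's rule for \<open>x powr a * l x\<close>: binomial coefficients times
    falling factorials of \<open>a\<close>.\<close>
  define H1 where "H1 x = a * x powr (a - 1) * l x + x powr a * L 1 x" for x
  define H2 where "H2 x = a * (a - 1) * x powr (a - 2) * l x + 2 * a * x powr (a - 1) * L 1 x
    + x powr a * L 2 x" for x
  define H3 where "H3 x = a * (a - 1) * (a - 2) * x powr (a - 3) * l x
    + 3 * a * (a - 1) * x powr (a - 2) * L 1 x + 3 * a * x powr (a - 1) * L 2 x
    + x powr a * L 3 x" for x
  define H4 where "H4 x = a * (a - 1) * (a - 2) * (a - 3) * x powr (a - 4) * l x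
    + 4 * a * (a - 1) * (a - 2) * x powr (a - 3) * L 1 x
    + 6 * a * (a - 1) * x powr (a - 2) * L 2 x + 4 * a * x powr (a - 1) * L 3 x
    + x powr a * L 4 x" for x
  have a_pos: "a > 0" and "a \<noteq> 1"
    using assms(1,2) by (auto simp: a_def)

  \<comment> \<open>Exposes the common factor \<open>x powr a\<close>, which cancels against the one
    in \<open>H x\<close>.\<close>
  have powr_minus: "x powr (a - 1) = x powr a / x" "x powr (a - 2) = x powr a / x ^ 2"
    "x powr (a - 3) = x powr a / x ^ 3" "x powr (a - 4) = x powr a / x ^ 4" if "x > 0" for x
    using that by (simp_all add: powr_diff)
  have l_pos: "\<forall>\<^sub>F x in at_top. x > 0 \<and> l x > 0"
    using eventually_gt_at_top[of "max x0 0"] assms(3)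
    by (auto simp: weibull_type_def elim: eventually_mono)
  have lims: "((\<lambda>x. x * L 1 x / l x) \<longlongrightarrow> 0) at_top" "((\<lambda>x. x ^ 2 * L 2 x / l x) \<longlongrightarrow> 0) at_top"
    "((\<lambda>x. x ^ 3 * L 3 x / l x) \<longlongrightarrow> 0) at_top" "((\<lambda>x. x ^ 4 * L 4 x / l x) \<longlongrightarrow> 0) at_top"
    using assms(5-8) by (simp_all add: L_def)

  \<comment> \<open>Division by \<open>H\<close> turns each Leibniz sum into a falling factorial of
    \<open>a\<close> plus multiples of the ratios \<open>x ^ j * L j x / l x\<close>, which vanish
    by assumption.\<close>
  have "((\<lambda>x. a + x * L 1 x / l x) \<longlongrightarrow> a + 0) at_top"
    by (intro tendsto_intros lims)
  then have "((\<lambda>x. a + x * L 1 x / l x) \<longlongrightarrow> a) at_top"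
    by simp
  then have lim_H1: "((\<lambda>x. x * H1 x / H x) \<longlongrightarrow> a) at_top"
    by (rule Lim_transform_eventually)
      (use l_pos in eventually_elim, simp add: H1_def H_eq powr_minus field_simps)

  have "((\<lambda>x. a * (a - 1) + 2 * a * (x * L 1 x / l x) + x ^ 2 * L 2 x / l x) \<longlongrightarrow>
      a * (a - 1) + 2 * a * 0 + 0) at_top"
    by (intro tendsto_intros lims)
  then have "((\<lambda>x. a * (a - 1) + 2 * a * (x * L 1 x / l x) + x ^ 2 * L 2 x / l x) \<longlongrightarrow>
      a * (a - 1)) at_top"
    by simp
  then have lim_H2: "((\<lambda>x. x ^ 2 * H2 x / H x) \<longlongrightarrow> a * (a - 1)) at_top"
    by (rule Lim_transform_eventually)
      (use l_pos in eventually_elim,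
        simp add: H2_def H_eq powr_minus divide_simps, simp add: algebra_simps eval_nat_numeral)

  have "((\<lambda>x. a * (a - 1) * (a - 2) + 3 * a * (a - 1) * (x * L 1 x / l x)
      + 3 * a * (x ^ 2 * L 2 x / l x) + x ^ 3 * L 3 x / l x) \<longlongrightarrow>
      a * (a - 1) * (a - 2) + 3 * a * (a - 1) * 0 + 3 * a * 0 + 0) at_top"
    by (intro tendsto_intros lims)
  then have "((\<lambda>x. a * (a - 1) * (a - 2) + 3 * a * (a - 1) * (x * L 1 x / l x)
      + 3 * a * (x ^ 2 * L 2 x / l x) + x ^ 3 * L 3 x / l x) \<longlongrightarrow> a * (a - 1) * (a - 2)) at_top"
    by simp
  then have lim_H3: "((\<lambda>x. x ^ 3 * H3 x / H x) \<longlongrightarrow> a * (a - 1) * (a - 2)) at_top"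
    by (rule Lim_transform_eventually)
      (use l_pos in eventually_elim,
        simp add: H3_def H_eq powr_minus divide_simps, simp add: algebra_simps eval_nat_numeral)

  have "((\<lambda>x. a * (a - 1) * (a - 2) * (a - 3) + 4 * a * (a - 1) * (a - 2) * (x * L 1 x / l x)
      + 6 * a * (a - 1) * (x ^ 2 * L 2 x / l x) + 4 * a * (x ^ 3 * L 3 x / l x)
      + x ^ 4 * L 4 x / l x) \<longlongrightarrow>
      a * (a - 1) * (a - 2) * (a - 3) + 4 * a * (a - 1) * (a - 2) * 0
      + 6 * a * (a - 1) * 0 + 4 * a * 0 + 0) at_top"
    by (intro tendsto_intros lims)
  then have "((\<lambda>x. a * (a - 1) * (a - 2) * (a - 3) + 4 * a * (a - 1) * (a - 2) * (x * L 1 x / l x)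
      + 6 * a * (a - 1) * (x ^ 2 * L 2 x / l x) + 4 * a * (x ^ 3 * L 3 x / l x)
      + x ^ 4 * L 4 x / l x) \<longlongrightarrow> a * (a - 1) * (a - 2) * (a - 3)) at_top"
    by simp
  then have lim_H4: "((\<lambda>x. x ^ 4 * H4 x / H x) \<longlongrightarrow> a * (a - 1) * (a - 2) * (a - 3)) at_top"
    by (rule Lim_transform_eventually)
      (use l_pos in eventually_elim,
        simp add: H4_def H_eq powr_minus divide_simps, simp add: algebra_simps eval_nat_numeral)

  \<comment> \<open>The positive limit \<open>a\<close> yields the eventual sign of
    \<open>H1\<close>. All eventual facts are then merged into one threshold
    \<open>X\<close>.\<close>
  have "\<forall>\<^sub>F x in at_top. x * H1 x / H x > 0"
    using a_pos by (rule order_tendstoD(1)[OF lim_H1])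
  then have "\<forall>\<^sub>F x in at_top. x \<ge> x0 \<and> x > 0 \<and> l x > 0 \<and> x * H1 x / H x > 0 \<and>
      (\<forall>j<4. L j differentiable (at x))"
    using l_pos assms(4) eventually_ge_at_top[of x0]
    unfolding L_def by eventually_elim auto
  then obtain X where X: "\<And>x. x > X \<Longrightarrow> x \<ge> x0 \<and> x > 0 \<and> l x > 0 \<and> x * H1 x / H x > 0 \<and>
      (\<forall>j<4. L j differentiable (at x))"
    unfolding eventually_at_top_dense by blast
  have X_pos: "x > 0" if "x > X" for x
    using X[OF that] by simp
  have DERIV_L: "(L j has_real_derivative L (Suc j) x) (at x)" if "x > X" "j < 4" for j x
    using X[OF that(1)] that(2) by (simp add: L_def DERIV_deriv_iff_real_differentiable)
  have DERIV_Ls: "(l has_real_derivative L 1 x) (at x)" "(L 1 has_real_derivative L 2 x) (at x)"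
    "(L 2 has_real_derivative L 3 x) (at x)" "(L 3 has_real_derivative L 4 x) (at x)" if "x > X" for x
    using DERIV_L[OF that, of 0] DERIV_L[OF that, of 1] DERIV_L[OF that, of 2] DERIV_L[OF that, of 3]
    by (simp_all add: L_def[of 0] eval_nat_numeral)
  have L_rules: "((\<lambda>x. c * x powr p * l x) has_real_derivative
        c * p * x powr (p - 1) * l x + c * x powr p * L 1 x) (at x)"
    "((\<lambda>x. c * x powr p * L 1 x) has_real_derivative
        c * p * x powr (p - 1) * L 1 x + c * x powr p * L 2 x) (at x)"
    "((\<lambda>x. c * x powr p * L 2 x) has_real_derivative
        c * p * x powr (p - 1) * L 2 x + c * x powr p * L 3 x) (at x)"
    "((\<lambda>x. c * x powr p * L 3 x) has_real_derivative
        c * p * x powr (p - 1) * L 3 x + c * x powr p * L 4 x) (at x)" if "x > X" for c p x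
    by (intro DERIV_powr_mult X_pos DERIV_Ls that)+
  \<comment> \<open>The last summand \<open>x powr a * L j x\<close> of each sum has no written
    coefficient, so it needs the rules with \<open>c = 1\<close> simplified.\<close>
  note L_rules1 = L_rules[where c = 1, unfolded mult_1_left]

  interpret smooth_tail F H H1 H2 H3 H4 a X
  proof
    fix x assume x: "x > X"
    show "F x = 1 - exp (- H x)"
      using assms(3) X[OF x] by (force simp: weibull_type_def H_def)
    show "H x > 0"
      using X[OF x] by (simp add: H_eq)
    then show "H1 x > 0"
      using X[OF x] by (auto simp: zero_less_divide_iff zero_less_mult_iff)
    show "(H has_real_derivative H1 x) (at x)"
      unfolding H_eq[abs_def] H1_def
      by (rule L_rules1 x)+
    show "(H1 has_real_derivative H2 x) (at x)"
      unfolding H1_def H2_def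
      by (rule derivative_eq_intros L_rules L_rules1 x refl)+ (simp add: algebra_simps)
    show "(H2 has_real_derivative H3 x) (at x)"
      unfolding H2_def H3_def
      by (rule derivative_eq_intros L_rules L_rules1 x refl)+ (simp add: algebra_simps)
    show "(H3 has_real_derivative H4 x) (at x)"
      unfolding H3_def H4_def
      by (rule derivative_eq_intros L_rules L_rules1 x refl)+ (simp add: algebra_simps)
  qed (use a_pos \<open>a \<noteq> 1\<close> lim_H1 lim_H2 lim_H3 lim_H4 weibull_type_H(2)[OF assms(3)] in
      \<open>simp_all add: H_def\<close>)

  \<comment> \<open>The penultimate index samples \<open>vm_phi F\<close> at these points. They tend
    to infinity, so its eventual sign carries over, with \<open>\<theta> > 1\<close> corresponding
    to \<open>a < 1\<close>.\<close>
  have lim_inverse: "filterlim (\<lambda>n. generalized_inverse H x0 (ln (real n))) at_top sequentially"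
    using generalized_inverse_ln_at_top[OF weibull_type_H[OF assms(3)]] by (simp add: H_def)
  have "penultimate_frechet F H x0" if "\<theta> > 1"
    unfolding penultimate_frechet_def penultimate_index_def
    using that by (intro eventually_compose_filterlim[OF eventually_vm_phi_pos lim_inverse]) (simp add: a_def)
  moreover have "penultimate_weibull F H x0" if "\<theta> < 1"
    unfolding penultimate_weibull_def penultimate_index_def
    using that assms(1)
    by (intro eventually_compose_filterlim[OF eventually_vm_phi_neg lim_inverse]) (simp add: a_def)
  ultimately show ?thesis
    using von_mises_first_order von_mises_second_order von_mises_penultimate
    by (simp add: H_def)
qed

end
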